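(* Let $a<b$ be real numbers and $0<\alpha<1$. Let $g$ be a differentiable function in $[a,b]$ with $g(a)=g(b)=0$, and let $f\in L_1([a,b])$ be such that there is a number $\varepsilon\in\,]a,b]$ with $|f(x)|\le c(x-a)^{\beta}$ for all $x\in[a,\varepsilon]$, where $c>0$ and $\beta>-\alpha$ are constants. Then $${_aJ}^{\alpha}_b\left(f(x)\,{_a^CD}^{\alpha}_x g(x)\right)=0\;\Rightarrow\; f\equiv K,$$ where $K$ is a constant.
   Context: For $\alpha>0$ and $h\in L_1([a,b])$, the left Riemann--Liouville fractional integral of order $\alpha$ is ${_aJ}^{\alpha}_x h(x):=\frac{1}{\Gamma(\alpha)}\int_a^x \frac{h(u)}{(x-u)^{1-\alpha}}\,du$, where $\Gamma$ is the Euler gamma function, and ${_aJ}^{\alpha}_b h$ denotes its value at $x=b$, i.e. ${_aJ}^{\alpha}_b h=\frac{1}{\Gamma(\alpha)}\int_a^b\frac{h(u)}{(b-u)^{1-\alpha}}\,du$. For $0<\alpha<1$, the left Caputo fractional derivative of order $\alpha$ of a function $g$ with $g'\in L_1([a,b])$ is ${_a^CD}^{\alpha}_x g(x):={_aJ}^{1-\alpha}_x g'(x)=\frac{1}{\Gamma(1-\alpha)}\int_a^x\frac{g'(u)}{(x-u)^{\alpha}}\,du$.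
   Formalization: The vanishing of the fractional integral is assumed for every admissible g (with g' in L_1), not for one fixed g, since for g = 0 the claim fails; and f ≡ K is taken almost everywhere on [a,b], since changing f at one point does not affect the hypothesis. *)

theory Defs
  imports "HOL-Analysis.Analysis"
begin

text \<open>
  The integrals are Lebesgue integrals. For order below 1 the kernel is singular at the right
  endpoint \<open>u = x\<close>, where division by zero gives the value 0; this affects only a null set.
\<close>

definition rl_integral :: "real \<Rightarrow> real \<Rightarrow> real \<Rightarrow> (real \<Rightarrow> real) \<Rightarrow> real" where
  "rl_integral a \<alpha> x h =
     1 / Gamma \<alpha> * (LINT u:{a..x}|lebesgue. h u / (x - u) powr (1 - \<alpha>))"

text \<open>
  For \<open>g\<close> differentiable on \<open>[a, b]\<close> and \<open>a < x \<le> b\<close>, the two-sided derivative \<open>deriv g\<close> is the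
  derivative of \<open>g\<close> at every point of the open interval \<open>]a, x[\<close>; its values at the endpoints do
  not influence the integral.
\<close>

definition caputo_deriv :: "real \<Rightarrow> real \<Rightarrow> real \<Rightarrow> (real \<Rightarrow> real) \<Rightarrow> real" where
  "caputo_deriv a \<alpha> x g = rl_integral a (1 - \<alpha>) x (deriv g)"

end

theory Submission
  imports Defs
begin

text \<open>
  The Caputo derivative of \<open>(x - s)\<^sub>+ powr (1 + \<alpha>) / \<Gamma>(2 + \<alpha>)\<close> is the ramp \<open>(x - s)\<^sub>+\<close>, by the
  Beta integral. Hence every trapezoid, being a combination of four ramps, is the Caputo derivative
  of an explicit \<open>C\<^sup>1\<close> function \<open>g\<close> with \<open>g a = 0\<close>, and \<open>g b\<close> is a multiple of its integral against
  the weight \<open>W x = (b - x) powr (\<alpha> - 1)\<close>. Subtracting a multiple of a fixed trapezoid enforces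
  \<open>g b = 0\<close>, so the hypothesis yields a constant \<open>K\<close> for which \<open>(f - K) W\<close> is orthogonal to all
  trapezoids vanishing near \<open>b\<close>; letting their slopes steepen, \<open>(f - K) W\<close> has integral zero over
  every interval and so vanishes almost everywhere. Vanishing near \<open>b\<close> is essential: \<open>f W\<close> need not
  be integrable there, and then the Lebesgue integral takes its default value 0, so that the
  hypothesis carries no information.
\<close>

section \<open>Beta integrals and integrability of the singular kernel\<close>

text \<open>The affine substitution \<open>u = s + L * t\<close> with \<open>L = x - s\<close> leads
  to Euler's integral on the unit interval; the two powers contribute
  \<open>L powr (p + q - 2)\<close> and the length element one more factor \<open>L\<close>.\<close>

lemma has_integral_Beta_Icc:
  fixes s x p q :: real
  assumes "s < x" "0 < p" "0 < q"
  shows "((\<lambda>u. (u - s) powr (p - 1) * (x - u) powr (q - 1)) has_integral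
           (x - s) powr (p + q - 1) * Beta p q) {s..x}"
proof -
  define L where "L = x - s"
  have L: "L > 0" using assms by (simp add: L_def)
  have "((\<lambda>t. t powr (p - 1) * (1 - t) powr (q - 1)) has_integral Beta p q) (cbox 0 1)"
    using has_integral_Beta_real[OF assms(2,3)] by simp
  from has_integral_affinity'[OF this, of "1 / L" "- s / L"] L
  have "((\<lambda>u. (u / L - s / L) powr (p - 1) * (1 - (u / L - s / L)) powr (q - 1))
          has_integral L * Beta p q) {L * (s / L)..L * (1 + s / L)}"
    by simp
  moreover have "L * (s / L) = s" "L * (1 + s / L) = x"
    using L by (simp_all add: L_def field_simps)
  ultimately have "((\<lambda>u. (u / L - s / L) powr (p - 1) * (1 - (u / L - s / L)) powr (q - 1))
          has_integral L * Beta p q) {s..x}"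
    by simp
  then have "((\<lambda>u. L powr (p + q - 2) * ((u / L - s / L) powr (p - 1) *
      (1 - (u / L - s / L)) powr (q - 1))) has_integral L powr (p + q - 2) * (L * Beta p q)) {s..x}"
    by (rule has_integral_mult_right)
  also have "L powr (p + q - 2) * (L * Beta p q) = L powr (p + q - 1) * Beta p q"
    using powr_mult_base[of L "p + q - 2"] L by (simp add: algebra_simps)
  finally have "((\<lambda>u. (u - s) powr (p - 1) * (x - u) powr (q - 1)) has_integral
      L powr (p + q - 1) * Beta p q) {s..x}"
  proof (rule has_integral_eq[rotated])
    fix u assume u: "u \<in> {s..x}"
    have "x = s + L" by (simp add: L_def)
    then have "u / L - s / L = (u - s) / L" "1 - (u / L - s / L) = (x - u) / L"
      using L by (auto simp: field_simps)
    moreover have "L powr (p + q - 2) = L powr (p - 1) * L powr (q - 1)"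
      by (simp add: powr_add[symmetric] algebra_simps)
    ultimately show "L powr (p + q - 2) * ((u / L - s / L) powr (p - 1) *
      (1 - (u / L - s / L)) powr (q - 1)) = (u - s) powr (p - 1) * (x - u) powr (q - 1)"
      using L u by (simp add: powr_divide)
  qed
  then show ?thesis by (simp add: L_def)
qed

text \<open>Truncation lets every shift \<open>s\<close> share the interval \<open>{a..x}\<close>:
  since \<open>0 powr r = 0\<close> for every \<open>r\<close>, including \<open>r = 0\<close>, the
  integrand vanishes up to \<open>s\<close>.\<close>

lemma has_integral_truncated_Beta:
  fixes a s x p q :: real
  assumes "a \<le> s" "0 < p" "0 < q"
  shows "((\<lambda>u. max 0 (u - s) powr (p - 1) * (x - u) powr (q - 1)) has_integral
           max 0 (x - s) powr (p + q - 1) * Beta p q) {a..x}"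
proof (cases "s < x")
  case True
  have "((\<lambda>u. max 0 (u - s) powr (p - 1) * (x - u) powr (q - 1)) has_integral
           max 0 (x - s) powr (p + q - 1) * Beta p q) {s..x}"
    using has_integral_Beta_Icc[OF True assms(2,3)] True
    by (auto intro: has_integral_eq[rotated])
  moreover have "((\<lambda>u. max 0 (u - s) powr (p - 1) * (x - u) powr (q - 1)) has_integral 0) {a..s}"
    by (rule has_integral_is_0) auto
  ultimately show ?thesis
    using has_integral_combine[of a s x] assms True by fastforce
next
  case False
  then have "max 0 (x - s) powr (p + q - 1) * Beta p q = 0" by simp
  moreover have "((\<lambda>u. max 0 (u - s) powr (p - 1) * (x - u) powr (q - 1)) has_integral 0) {a..x}"
    by (rule has_integral_eq[OF _ has_integral_0]) (use False in auto)
  ultimately show ?thesis by metis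
qed

lemma powr_kernel_absolutely_integrable:
  fixes a x q :: real
  assumes "0 < q"
  shows "(\<lambda>u. (x - u) powr (q - 1)) absolutely_integrable_on {a..x}"
proof -
  \<comment> \<open>For \<open>p = 1\<close> the first factor is the indicator of
    \<open>u > a - 1\<close>, because \<open>0 powr 0 = 0\<close>; starting one unit to the left
    makes it 1 on all of \<open>{a..x}\<close>, endpoint included.\<close>
  have "(\<lambda>u. max 0 (u - (a - 1)) powr (1 - 1) * (x - u) powr (q - 1)) integrable_on {a - 1..x}"
    using has_integral_truncated_Beta[of "a - 1" "a - 1" 1 q x] assms by (auto simp: integrable_on_def)
  then have "(\<lambda>u. max 0 (u - (a - 1)) powr (1 - 1) * (x - u) powr (q - 1)) integrable_on {a..x}"
    by (rule integrable_on_subinterval) auto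
  then have "(\<lambda>u. (x - u) powr (q - 1)) integrable_on {a..x}"
    by (rule integrable_eq) auto
  then show ?thesis
    by (rule nonnegative_absolutely_integrable_1) auto
qed

section \<open>Real analysis: truncated powers and functions with zero integrals\<close>

lemma absolutely_integrable_continuous_mult:
  fixes f g :: "real \<Rightarrow> real"
  assumes "continuous_on {a..b} f" "g absolutely_integrable_on {a..b}"
  shows "(\<lambda>x. f x * g x) absolutely_integrable_on {a..b}"
proof (rule absolutely_integrable_bounded_measurable_product_real)
  show "f \<in> borel_measurable (lebesgue_on {a..b})"
    using assms(1) by (intro continuous_imp_measurable_on_sets_lebesgue) auto
  show "bounded (f ` {a..b})"
    using assms(1) by (intro compact_imp_bounded compact_continuous_image) auto
qed (use assms in auto)

lemma has_real_derivative_truncated_powr: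
  fixes x s p :: real
  assumes "1 < p"
  shows "((\<lambda>x. max 0 (x - s) powr p) has_real_derivative p * max 0 (x - s) powr (p - 1)) (at x)"
proof -
  consider "x < s" | "x = s" | "x > s" by linarith
  then show ?thesis
  proof cases
    case 1
    have "((\<lambda>x. 0) has_real_derivative 0) (at x)" by simp
    then have "((\<lambda>x. max 0 (x - s) powr p) has_real_derivative 0) (at x)"
      by (rule has_field_derivative_transform_within_open[of _ _ _ "{..<s}"]) (use 1 in auto)
    then show ?thesis using 1 by simp
  next
    case 2
    \<comment> \<open>At the kink the difference quotient is 0 on the left and
      \<open>h powr (p - 1)\<close> on the right, which tends to 0 because
      \<open>1 < p\<close>.\<close>
    have "((\<lambda>h. \<bar>h\<bar> powr (p - 1)) \<longlongrightarrow> 0) (at 0)"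
      by (rule tendsto_eq_intros refl | use assms in simp)+
    then have "((\<lambda>h. (max 0 (s + h - s) powr p - max 0 (s - s) powr p) / h) \<longlongrightarrow> 0) (at 0)"
    proof (rule Lim_null_comparison[rotated])
      show "\<forall>\<^sub>F h in at 0. norm ((max 0 (s + h - s) powr p - max 0 (s - s) powr p) / h) \<le> \<bar>h\<bar> powr (p - 1)"
        using assms by (intro always_eventually allI) (auto simp: max_def powr_diff divide_simps)
    qed
    then show ?thesis using 2 by (simp add: DERIV_def)
  next
    case 3
    have "((\<lambda>x. (x - s) powr p) has_real_derivative p * (x - s) powr (p - 1)) (at x)"
      using 3 by (auto intro!: derivative_eq_intros simp: powr_diff)
    then have "((\<lambda>x. max 0 (x - s) powr p) has_real_derivative p * (x - s) powr (p - 1)) (at x)"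
      by (rule has_field_derivative_transform_within_open[of _ _ _ "{s<..}"]) (use 3 in auto)
    then show ?thesis using 3 by simp
  qed
qed

text \<open>The Borel sets over which \<open>h\<close> integrates to 0 are closed under complements
  and countable disjoint unions and contain the compact intervals, so they are all Borel sets.
  Lebesgue sets differ from these by null sets, and densities with equal integrals over all
  measurable sets agree almost everywhere.\<close>

lemma AE_eq_0_if_Icc_integrals_0:
  fixes h :: "real \<Rightarrow> real"
  assumes int: "integrable lebesgue h"
    and zero: "\<And>s t. s \<le> t \<Longrightarrow> (LINT x:{s..t}|lebesgue. h x) = 0"
  shows "AE x in lebesgue. h x = 0"
proof -
  have si: "set_integrable lebesgue A h" if "A \<in> sets lebesgue" for A
    unfolding set_integrable_def by (rule integrable_mult_indicator) fact+
  \<comment> \<open>Closure under complements needs the integral over the whole line, obtained as a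
    limit over \<open>{- n..n}\<close>.\<close>
  have total: "(LINT x|lebesgue. h x) = 0"
  proof -
    have "(\<lambda>n. LINT x|lebesgue. indicator {- real n..real n} x *\<^sub>R h x) \<longlonglongrightarrow> (LINT x|lebesgue. h x)"
    proof (rule integral_dominated_convergence[where w = "\<lambda>x. \<bar>h x\<bar>"])
      show "AE x in lebesgue. (\<lambda>n. indicat_real {- real n..real n} x *\<^sub>R h x) \<longlonglongrightarrow> h x"
      proof (rule AE_I2)
        fix x :: real
        obtain N :: nat where "\<bar>x\<bar> < N" using reals_Archimedean2 by blast
        then have "\<forall>\<^sub>F n in sequentially. indicat_real {- real n..real n} x *\<^sub>R h x = h x"
          by (intro eventually_sequentiallyI[of N]) (auto simp: indicator_def)
        then show "(\<lambda>n. indicat_real {- real n..real n} x *\<^sub>R h x) \<longlonglongrightarrow> h x"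
          by (rule tendsto_eventually)
      qed
      show "(\<lambda>x. indicat_real {- real n..real n} x *\<^sub>R h x) \<in> borel_measurable lebesgue" for n
        using si[of "{- real n..real n}"] by (simp add: set_integrable_def)
    qed (use int in \<open>auto simp: indicator_def\<close>)
    moreover have "(LINT x|lebesgue. indicator {- real n..real n} x *\<^sub>R h x) = 0" for n
      using zero[of "- real n" "real n"] by (simp add: set_lebesgue_integral_def)
    ultimately have "(\<lambda>n. 0) \<longlonglongrightarrow> (LINT x|lebesgue. h x)" by simp
    then show ?thesis by (simp add: LIMSEQ_const_iff)
  qed
  have borel: "(LINT x:A|lebesgue. h x) = 0" if "A \<in> sets borel" for A
    using that
  proof (induction rule: borel_set_induct)
    case empty
    show ?case by (simp add: set_lebesgue_integral_def)
  next
    case (interval s t)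
    then show ?case by (rule zero)
  next
    case (compl A)
    then have A: "A \<in> sets lebesgue" "- A \<in> sets lebesgue" by auto
    have "(LINT x:A \<union> - A|lebesgue. h x) = (LINT x:A|lebesgue. h x) + (LINT x:-A|lebesgue. h x)"
      by (rule set_integral_Un) (use A si in auto)
    moreover have "(LINT x:A \<union> - A|lebesgue. h x) = 0"
      using total by (simp add: set_lebesgue_integral_def Compl_partition)
    ultimately show ?case using compl by simp
  next
    case (union A)
    then have A: "A i \<in> sets lebesgue" for i by auto
    have "(LINT x:(\<Union>i. A i)|lebesgue. h x) = (\<Sum>i. LINT x:A i|lebesgue. h x)"
    proof (rule lebesgue_integral_countable_add)
      show "A i \<inter> A j = {}" if "i \<noteq> j" for i j
        using union that by (auto simp: disjoint_family_on_def)
      show "set_integrable lebesgue (\<Union>i. A i) h"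
        using A by (intro si) auto
    qed (use A in auto)
    then show ?case using union by simp
  qed
  show ?thesis
  proof (rule density_unique_real)
    fix A :: "real set" assume A: "A \<in> sets lebesgue"
    then obtain S N N' where S: "A = S \<union> N" "N \<subseteq> N'" "N' \<in> null_sets lborel" "S \<in> sets lborel"
      by (rule sets_completionE)
    have null: "(A - S) \<union> (S - A) \<in> null_sets lebesgue"
      unfolding null_sets_completion_iff2 using S by (intro bexI[of _ N']) auto
    have "(LINT x:A|lebesgue. h x) = (LINT x:S|lebesgue. h x)"
      by (rule set_integral_null_delta) (use S A int null in auto)
    then show "(LINT x:A|lebesgue. h x) = (LINT x:A|lebesgue. 0)"
      using borel S by simp
  qed (use int in auto)
qed

section \<open>Functions with prescribed Caputo derivative\<close>

text \<open>Continuity of \<open>h\<close> makes the product with the kernel absolutely integrable,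
  so Lebesgue and gauge integral agree and Beta integrals can be inserted.\<close>

lemma rl_integral_eq_integral:
  fixes a x \<gamma> :: real
  assumes "0 < \<gamma>" "continuous_on {a..x} h"
  shows "rl_integral a \<gamma> x h = integral {a..x} (\<lambda>u. h u * (x - u) powr (\<gamma> - 1)) / Gamma \<gamma>"
proof -
  have "h u / (x - u) powr (1 - \<gamma>) = h u * (x - u) powr (\<gamma> - 1)" for u
    using powr_minus_divide[of "x - u" "1 - \<gamma>"] by simp
  moreover have "(\<lambda>u. h u * (x - u) powr (\<gamma> - 1)) absolutely_integrable_on {a..x}"
    using assms by (intro absolutely_integrable_continuous_mult powr_kernel_absolutely_integrable)
  ultimately show ?thesis
    by (simp add: rl_integral_def set_lebesgue_integral_eq_integral)
qed

text \<open>
  The last clause is the identity \<open>J\<^sup>\<alpha> D\<^sup>\<alpha> g = g\<close> at the endpoint \<open>b\<close>, stated as a property of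
  \<open>\<phi>\<close> so that it can be checked directly on ramps instead of via Fubini.
\<close>

definition caputo_test :: "real \<Rightarrow> real \<Rightarrow> real \<Rightarrow> (real \<Rightarrow> real) \<Rightarrow> real \<Rightarrow> bool" where
  "caputo_test a b \<alpha> \<phi> m \<longleftrightarrow>
     continuous_on {a..b} \<phi> \<and>
     (\<exists>g g'. (\<forall>x. (g has_real_derivative g' x) (at x)) \<and> continuous_on UNIV g' \<and>
             g a = 0 \<and> g b = m \<and> (\<forall>x\<in>{a..b}. caputo_deriv a \<alpha> x g = \<phi> x)) \<and>
     integral {a..b} (\<lambda>x. \<phi> x * (b - x) powr (\<alpha> - 1)) = Gamma \<alpha> * m"

lemma caputo_deriv_eq_integral:
  fixes a x \<alpha> :: real
  assumes "\<alpha> < 1" "\<And>x. (g has_real_derivative g' x) (at x)" "continuous_on UNIV g'"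
  shows "caputo_deriv a \<alpha> x g = integral {a..x} (\<lambda>u. g' u * (x - u) powr (- \<alpha>)) / Gamma (1 - \<alpha>)"
proof -
  have "deriv g = g'"
    using assms(2) by (intro ext DERIV_imp_deriv)
  then show ?thesis
    using assms rl_integral_eq_integral[of "1 - \<alpha>" a x g'] continuous_on_subset[of UNIV g']
    by (simp add: caputo_deriv_def)
qed

text \<open>Two Beta integrals supply the constants: \<open>Beta (1 + \<alpha>) (1 - \<alpha>) =
  Gamma (1 + \<alpha>) * Gamma (1 - \<alpha>)\<close> cancels the normalisations in the Caputo
  derivative, and \<open>Beta 2 \<alpha> = Gamma \<alpha> / Gamma (2 + \<alpha>)\<close> gives the
  identity at \<open>b\<close>.\<close>

lemma caputo_test_ramp:
  fixes a b s \<alpha> :: real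
  assumes "0 < \<alpha>" "\<alpha> < 1" "a \<le> s"
  shows "caputo_test a b \<alpha> (\<lambda>x. max 0 (x - s)) (max 0 (b - s) powr (1 + \<alpha>) / Gamma (2 + \<alpha>))"
proof -
  define g where "g x = max 0 (x - s) powr (1 + \<alpha>) / Gamma (2 + \<alpha>)" for x
  define g' where "g' x = max 0 (x - s) powr \<alpha> / Gamma (1 + \<alpha>)" for x
  have G: "Gamma (2 + \<alpha>) = (1 + \<alpha>) * Gamma (1 + \<alpha>)"
    using Gamma_plus1[of "1 + \<alpha>"] assms by (force simp: add_ac elim!: nonpos_Ints_cases)
  have G1: "Gamma (1 + \<alpha>) > 0" "Gamma (1 - \<alpha>) > 0" "Gamma \<alpha> > 0"
    using assms by (auto intro: Gamma_real_pos)
  then have G2: "Gamma (1 + \<alpha>) \<noteq> 0" "Gamma (1 - \<alpha>) \<noteq> 0" "Gamma \<alpha> \<noteq> 0" by linarith+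
  have der: "(g has_real_derivative g' x) (at x)" for x
    unfolding g_def[abs_def] g'_def G
    using DERIV_cdivide[OF has_real_derivative_truncated_powr[of "1 + \<alpha>" s x], of "(1 + \<alpha>) * Gamma (1 + \<alpha>)"]
      assms G2 by simp
  have cont: "continuous_on UNIV g'"
    unfolding g'_def
    by (intro continuous_on_divide continuous_on_powr' continuous_intros ballI) (use assms G2 in auto)
  have cap: "caputo_deriv a \<alpha> x g = max 0 (x - s)" for x
  proof -
    have "integral {a..x} (\<lambda>u. g' u * (x - u) powr (- \<alpha>)) =
        integral {a..x} (\<lambda>u. max 0 (u - s) powr \<alpha> * (x - u) powr (- \<alpha>)) / Gamma (1 + \<alpha>)"
      by (simp add: g'_def flip: integral_divide)
    also have "integral {a..x} (\<lambda>u. max 0 (u - s) powr \<alpha> * (x - u) powr (- \<alpha>)) =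
        max 0 (x - s) * Beta (1 + \<alpha>) (1 - \<alpha>)"
      using has_integral_truncated_Beta[of a s "1 + \<alpha>" "1 - \<alpha>" x] assms
      by (simp add: integral_unique)
    also have "Beta (1 + \<alpha>) (1 - \<alpha>) = Gamma (1 + \<alpha>) * Gamma (1 - \<alpha>)"
      by (simp add: Beta_def Gamma_numeral)
    finally show ?thesis
      using caputo_deriv_eq_integral[OF assms(2) der cont] G2 by simp
  qed
  have "integral {a..b} (\<lambda>x. max 0 (x - s) * (b - x) powr (\<alpha> - 1)) = max 0 (b - s) powr (1 + \<alpha>) * Beta 2 \<alpha>"
    using has_integral_truncated_Beta[of a s 2 \<alpha> b] assms
    by (simp add: integral_unique add_ac)
  also have "\<dots> = Gamma \<alpha> * g b"
    by (simp add: g_def Beta_def Gamma_numeral)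
  finally show ?thesis
    unfolding caputo_test_def using der cont cap assms
    by (intro conjI exI[of _ g] exI[of _ g'] continuous_intros) (auto simp: g_def)
qed

text \<open>Continuity of the test functions and of the derivatives of their witnesses makes all
  kernel integrals converge absolutely, so they split termwise.\<close>

lemma caputo_test_lincomb:
  fixes a b \<alpha> p q :: real
  assumes "0 < \<alpha>" "\<alpha> < 1" "caputo_test a b \<alpha> \<phi> m" "caputo_test a b \<alpha> \<psi> n"
  shows "caputo_test a b \<alpha> (\<lambda>x. p * \<phi> x + q * \<psi> x) (p * m + q * n)"
proof -
  \<comment> \<open>Used with \<open>r = 1 - \<alpha>\<close> for the Caputo derivatives and with
    \<open>r = \<alpha>\<close> for the weighted integral.\<close>
  have integral_lincomb: "integral {a..x} (\<lambda>u. (p * h u + q * k u) * (x - u) powr (r - 1)) =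
      p * integral {a..x} (\<lambda>u. h u * (x - u) powr (r - 1)) + q * integral {a..x} (\<lambda>u. k u * (x - u) powr (r - 1))"
    if "continuous_on {a..x} h" "continuous_on {a..x} k" "0 < r" for h k :: "real \<Rightarrow> real" and x r
  proof -
    have "(\<lambda>u. h u * (x - u) powr (r - 1)) integrable_on {a..x}"
         "(\<lambda>u. k u * (x - u) powr (r - 1)) integrable_on {a..x}"
      using that by (auto intro!: set_lebesgue_integral_eq_integral(1)
          absolutely_integrable_continuous_mult powr_kernel_absolutely_integrable)
    then show ?thesis
      by (simp add: distrib_right mult.assoc integral_add integrable_on_mult_right)
  qed
  from assms obtain g g' where g: "\<And>x. (g has_real_derivative g' x) (at x)" "continuous_on UNIV g'"
      "g a = 0" "g b = m" "\<And>x. x \<in> {a..b} \<Longrightarrow> caputo_deriv a \<alpha> x g = \<phi> x"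
    unfolding caputo_test_def by metis
  from assms obtain k k' where k: "\<And>x. (k has_real_derivative k' x) (at x)" "continuous_on UNIV k'"
      "k a = 0" "k b = n" "\<And>x. x \<in> {a..b} \<Longrightarrow> caputo_deriv a \<alpha> x k = \<psi> x"
    unfolding caputo_test_def by metis
  let ?g = "\<lambda>x. p * g x + q * k x" and ?g' = "\<lambda>x. p * g' x + q * k' x"
  have der: "(?g has_real_derivative ?g' x) (at x)" for x
    by (intro DERIV_add DERIV_cmult g k)
  have cont: "continuous_on UNIV ?g'"
    by (intro continuous_intros g k)
  have "caputo_deriv a \<alpha> x ?g = p * \<phi> x + q * \<psi> x" if "x \<in> {a..b}" for x
    unfolding caputo_deriv_eq_integral[OF assms(2) der cont] g(5)[OF that, symmetric] k(5)[OF that, symmetric]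
      caputo_deriv_eq_integral[OF assms(2) g(1,2)] caputo_deriv_eq_integral[OF assms(2) k(1,2)]
    using integral_lincomb[of x g' k' "1 - \<alpha>"] continuous_on_subset[OF g(2)] continuous_on_subset[OF k(2)] assms
    by (simp add: add_divide_distrib)
  then show ?thesis
    using assms g k der cont integral_lincomb[of b \<phi> \<psi> \<alpha>] unfolding caputo_test_def
    by (intro conjI exI[of _ ?g] exI[of _ ?g'] continuous_intros) (auto simp: distrib_left)
qed

section \<open>Trapezoids\<close>

text \<open>Each bracket is a ramp saturating at height \<open>h\<close>. For
  \<open>s + h \<le> t\<close> the graph rises on \<open>[s, s + h]\<close>, stays at 1 up to
  \<open>t\<close> and falls to 0 on \<open>[t, t + h]\<close>. Writing it with four ramps makes
  \<open>caputo_test_lincomb\<close> applicable.\<close>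

definition trapezoid :: "real \<Rightarrow> real \<Rightarrow> real \<Rightarrow> real \<Rightarrow> real" where
  "trapezoid s t h x =
     1 / h * (max 0 (x - s) - max 0 (x - (s + h))) - 1 / h * (max 0 (x - t) - max 0 (x - (t + h)))"

lemma continuous_on_trapezoid: "continuous_on A (trapezoid s t h)"
  unfolding trapezoid_def divide_inverse by (intro continuous_intros)

text \<open>A ramp minus its shift by \<open>h\<close>, divided by \<open>h\<close>, clamps
  \<open>y / h\<close> to the unit interval. Bounds, support and plateau follow from this
  form.\<close>

lemma trapezoid_eq_clamp:
  assumes "0 < h"
  shows "trapezoid s t h x = min 1 (max 0 ((x - s) / h)) - min 1 (max 0 ((x - t) / h))"
proof -
  have "1 / h * (max 0 y - max 0 (y - h)) = min 1 (max 0 (y / h))" for y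
    using assms by (auto simp: max_def min_def field_simps)
  from this[of "x - s"] this[of "x - t"] show ?thesis
    by (simp add: trapezoid_def diff_diff_eq)
qed

lemma trapezoid_bounds:
  assumes "0 < h" "s \<le> t"
  shows "0 \<le> trapezoid s t h x" "trapezoid s t h x \<le> 1"
proof -
  have "(x - t) / h \<le> (x - s) / h"
    using assms by (intro divide_right_mono) auto
  then show "0 \<le> trapezoid s t h x" "trapezoid s t h x \<le> 1"
    using assms by (simp_all add: trapezoid_eq_clamp)
qed

lemma trapezoid_eq_0:
  assumes "0 < h" "s \<le> t" "x \<le> s \<or> t + h \<le> x"
  shows "trapezoid s t h x = 0"
proof (cases "x \<le> s")
  case True
  then have "(x - s) / h \<le> 0" "(x - t) / h \<le> 0"
    using assms by (auto simp: divide_nonpos_pos)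
  then show ?thesis using assms by (simp add: trapezoid_eq_clamp)
next
  case False
  then have "1 \<le> (x - s) / h" "1 \<le> (x - t) / h"
    using assms by (auto simp: le_divide_eq)
  then show ?thesis using assms by (simp add: trapezoid_eq_clamp)
qed

lemma trapezoid_eq_1:
  assumes "0 < h" "s + h \<le> x" "x \<le> t"
  shows "trapezoid s t h x = 1"
proof -
  have "1 \<le> (x - s) / h" "(x - t) / h \<le> 0"
    using assms by (auto simp: le_divide_eq divide_nonpos_pos)
  then show ?thesis using assms by (simp add: trapezoid_eq_clamp)
qed

text \<open>The rising slope lies to the right of \<open>s\<close> and the falling one to the right
  of \<open>t\<close>, so the value is 0 at \<open>s\<close> and eventually 1 at \<open>t\<close>;
  this makes the limit half-open.\<close>

lemma trapezoid_tendsto_indicator: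
  assumes "s < t" "0 < d"
  shows "(\<lambda>n. trapezoid s t (d / Suc n) x) \<longlonglongrightarrow> indicator {s<..t} x"
proof -
  consider "x \<le> s" | "s < x" "x \<le> t" | "t < x" by linarith
  then have "\<forall>\<^sub>F n in sequentially. trapezoid s t (d / Suc n) x = indicator {s<..t} x"
  proof cases
    case 1
    then show ?thesis using assms by (auto simp: trapezoid_eq_0)
  next
    case 2
    have "(\<lambda>n. d / Suc n) \<longlonglongrightarrow> 0" by (rule LIMSEQ_Suc[OF lim_const_over_n])
    then have "\<forall>\<^sub>F n in sequentially. d / Suc n < x - s"
      using 2 by (intro order_tendstoD) auto
    then show ?thesis
      by eventually_elim (use 2 assms in \<open>auto simp: trapezoid_eq_1\<close>)
  next
    case 3
    have "(\<lambda>n. d / Suc n) \<longlonglongrightarrow> 0" by (rule LIMSEQ_Suc[OF lim_const_over_n])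
    then have "\<forall>\<^sub>F n in sequentially. d / Suc n < x - t"
      using 3 by (intro order_tendstoD) auto
    then show ?thesis
      by eventually_elim (use 3 assms in \<open>auto simp: trapezoid_eq_0\<close>)
  qed
  then show ?thesis by (rule tendsto_eventually)
qed

text \<open>All four ramps start at or after \<open>a\<close>. The value \<open>m\<close> may stay
  anonymous, since the integral identity in \<open>caputo_test\<close> determines it.\<close>

lemma caputo_test_trapezoid:
  fixes a b s t h \<alpha> :: real
  assumes "0 < \<alpha>" "\<alpha> < 1" "a \<le> s" "s \<le> t" "0 < h"
  obtains m where "caputo_test a b \<alpha> (trapezoid s t h) m"
proof -
  define M where "M s = max 0 (b - s) powr (1 + \<alpha>) / Gamma (2 + \<alpha>)" for s
  have ramp: "caputo_test a b \<alpha> (\<lambda>x. max 0 (x - s)) (M s)" if "a \<le> s" for s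
    unfolding M_def using assms that by (intro caputo_test_ramp)
  have "caputo_test a b \<alpha> (\<lambda>x. 1 * (1 / h * max 0 (x - s) + (- 1 / h) * max 0 (x - (s + h)))
      + 1 * ((- 1 / h) * max 0 (x - t) + 1 / h * max 0 (x - (t + h))))
      (1 * (1 / h * M s + (- 1 / h) * M (s + h)) + 1 * ((- 1 / h) * M t + 1 / h * M (t + h)))"
    by (rule caputo_test_lincomb[OF assms(1,2)] ramp | use assms in simp)+
  moreover have "(\<lambda>x. 1 * (1 / h * max 0 (x - s) + (- 1 / h) * max 0 (x - (s + h)))
      + 1 * ((- 1 / h) * max 0 (x - t) + 1 / h * max 0 (x - (t + h)))) = trapezoid s t h"
    by (rule ext) (simp add: trapezoid_def algebra_simps)
  ultimately show ?thesis using that by metis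
qed

section \<open>Integrability at the endpoint and admissible test functions\<close>

lemma absolutely_integrable_on_Icc_extend:
  fixes f :: "real \<Rightarrow> real"
  assumes "f absolutely_integrable_on {a..c}" "c \<le> b" "\<And>x. c \<le> x \<Longrightarrow> x \<le> b \<Longrightarrow> f x = 0"
  shows "f absolutely_integrable_on {a..b}"
proof -
  have "(\<lambda>x. indicator {a..b} x *\<^sub>R f x) = (\<lambda>x. indicator {a..c} x *\<^sub>R f x)"
    using assms(2,3) by (fastforce simp: indicator_def)
  then show ?thesis
    using assms(1) by (simp add: set_integrable_def)
qed

text \<open>As \<open>\<phi>\<close> vanishes from \<open>c\<close> on, a singularity of the weight
  at \<open>b\<close> is cut off; on \<open>{a..c}\<close> the factor multiplying \<open>f\<close>
  is continuous, hence bounded.\<close>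

lemma absolutely_integrable_weighted:
  fixes f \<phi> :: "real \<Rightarrow> real"
  assumes "f absolutely_integrable_on {a..b}" "continuous_on {a..b} \<phi>" "c < b"
    and "\<And>x. c \<le> x \<Longrightarrow> x \<le> b \<Longrightarrow> \<phi> x = 0"
  shows "(\<lambda>x. f x * \<phi> x * (b - x) powr r) absolutely_integrable_on {a..b}"
proof (rule absolutely_integrable_on_Icc_extend)
  have "continuous_on {a..c} (\<lambda>x. \<phi> x * (b - x) powr r)"
    using assms(3) by (intro continuous_intros continuous_on_subset[OF assms(2)]) auto
  moreover have "f absolutely_integrable_on {a..c}"
    using assms(1,3) by (auto intro: set_integrable_subset)
  ultimately have "(\<lambda>x. (\<phi> x * (b - x) powr r) * f x) absolutely_integrable_on {a..c}"
    by (rule absolutely_integrable_continuous_mult)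
  then show "(\<lambda>x. f x * \<phi> x * (b - x) powr r) absolutely_integrable_on {a..c}"
    by (simp add: ac_simps)
qed (use assms in auto)

text \<open>Terminal value 0 makes the witness \<open>g\<close> admissible in \<open>orth\<close>.
  The premise \<open>int\<close> excludes the default value 0 of a divergent Lebesgue integral, so
  that the equation has content.\<close>

lemma caputo_test_0_orthogonal:
  fixes a b \<alpha> :: real and f \<phi> :: "real \<Rightarrow> real"
  assumes "a < b" "0 < \<alpha>" "\<alpha> < 1" "caputo_test a b \<alpha> \<phi> 0"
    and int: "(\<lambda>x. f x * \<phi> x * (b - x) powr (\<alpha> - 1)) absolutely_integrable_on {a..b}"
    and orth: "\<forall>g :: real \<Rightarrow> real.
           g differentiable_on {a..b} \<and> deriv g absolutely_integrable_on {a..b} \<and>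
           g a = 0 \<and> g b = 0 \<longrightarrow>
           rl_integral a \<alpha> b (\<lambda>x. f x * caputo_deriv a \<alpha> x g) = 0"
  shows "integral {a..b} (\<lambda>x. f x * \<phi> x * (b - x) powr (\<alpha> - 1)) = 0"
proof -
  from assms obtain g g' where g: "\<And>x. (g has_real_derivative g' x) (at x)" "continuous_on UNIV g'"
      "g a = 0" "g b = 0" "\<And>x. x \<in> {a..b} \<Longrightarrow> caputo_deriv a \<alpha> x g = \<phi> x"
    unfolding caputo_test_def by metis
  have "deriv g = g'"
    using g(1) by (intro ext DERIV_imp_deriv)
  then have "deriv g absolutely_integrable_on {a..b}"
    using continuous_on_subset[OF g(2), of "{a..b}"] by (auto intro: absolutely_integrable_continuous_real)
  moreover have "g differentiable_on {a..b}"
    unfolding differentiable_on_def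
    using g(1) by (meson differentiable_at_withinI real_differentiable_def)
  ultimately have "rl_integral a \<alpha> b (\<lambda>x. f x * caputo_deriv a \<alpha> x g) = 0"
    using orth g by blast
  then have "(LINT x:{a..b}|lebesgue. f x * caputo_deriv a \<alpha> x g / (b - x) powr (1 - \<alpha>)) = 0"
    using Gamma_real_pos[OF assms(2)] by (simp add: rl_integral_def)
  also have "(LINT x:{a..b}|lebesgue. f x * caputo_deriv a \<alpha> x g / (b - x) powr (1 - \<alpha>)) =
      (LINT x:{a..b}|lebesgue. f x * \<phi> x * (b - x) powr (\<alpha> - 1))"
  proof (rule set_lebesgue_integral_cong)
    \<comment> \<open>At \<open>x = b\<close> both sides are 0: division by zero on the left,
      \<open>0 powr r = 0\<close> on the right.\<close>
    show "\<forall>x. x \<in> {a..b} \<longrightarrow> f x * caputo_deriv a \<alpha> x g / (b - x) powr (1 - \<alpha>) =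
        f x * \<phi> x * (b - x) powr (\<alpha> - 1)"
      using g(5) powr_minus_divide[of "b - _" "1 - \<alpha>"] by simp
  qed auto
  finally show ?thesis
    using int by (simp add: set_lebesgue_integral_eq_integral)
qed

section \<open>The constant and the almost everywhere identity\<close>

theorem lemma3p2:
  fixes a b \<alpha> \<beta> c \<epsilon> :: real and f :: "real \<Rightarrow> real"
  assumes "a < b" and "0 < \<alpha>" and "\<alpha> < 1"
    and "f absolutely_integrable_on {a..b}"
    and "\<epsilon> \<in> {a<..b}" and "c > 0" and "\<beta> > - \<alpha>"
    and "\<forall>x\<in>{a<..\<epsilon>}. \<bar>f x\<bar> \<le> c * (x - a) powr \<beta>"
    and "\<forall>g :: real \<Rightarrow> real.
           g differentiable_on {a..b} \<and> deriv g absolutely_integrable_on {a..b} \<and>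
           g a = 0 \<and> g b = 0 \<longrightarrow>
           rl_integral a \<alpha> b (\<lambda>x. f x * caputo_deriv a \<alpha> x g) = 0"
  shows "\<exists>K. AE x in lebesgue. x \<in> {a..b} \<longrightarrow> f x = K"
proof -
  define W where "W x = (b - x) powr (\<alpha> - 1)" for x
  have Gamma: "Gamma \<alpha> > 0" using assms(2) by (rule Gamma_real_pos)
  \<comment> \<open>The gap \<open>t + h < b\<close> keeps the support away from the singularity of
    \<open>W\<close>. The factor \<open>k\<close> will be \<open>f\<close>, the constant 1, and
    \<open>f - K\<close>.\<close>
  have trapezoid_int: "(\<lambda>x. k x * trapezoid s t h x * W x) absolutely_integrable_on {a..b}"
    if "s \<le> t" "0 < h" "t + h < b" "k absolutely_integrable_on {a..b}" for s t h k
    unfolding W_def using that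
    by (intro absolutely_integrable_weighted[where c = "t + h"] continuous_on_trapezoid)
       (auto intro: trapezoid_eq_0)

  \<comment> \<open>Quarters of the interval: \<open>\<tau>\<close> is 1 on the second and vanishes
    on the last.\<close>
  define d where "d = (b - a) / 4"
  define \<tau> where "\<tau> = trapezoid a (a + 2 * d) d"
  have d: "0 < d" "a + 4 * d = b" using assms(1) by (auto simp: d_def field_simps)
  obtain m0 where m0: "caputo_test a b \<alpha> \<tau> m0"
    unfolding \<tau>_def using assms d caputo_test_trapezoid[of \<alpha> a a "a + 2 * d" d b] by auto
  have f\<tau>: "(\<lambda>x. f x * \<tau> x * W x) absolutely_integrable_on {a..b}"
    unfolding \<tau>_def using d assms by (intro trapezoid_int) auto
  have \<tau>W: "(\<lambda>x. \<tau> x * W x) integrable_on {a..b}"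
    using trapezoid_int[of a "a + 2 * d" d "\<lambda>_. 1"] d
    by (simp add: \<tau>_def set_lebesgue_integral_eq_integral)
  \<comment> \<open>\<open>m0\<close> will be a divisor. On the plateau of \<open>\<tau>\<close> the
    weight is at least \<open>(b - a) powr (\<alpha> - 1)\<close>, the exponent being
    negative.\<close>
  have "m0 > 0"
  proof -
    have "0 < integral {a + d..a + 2 * d} (\<lambda>x. (b - a) powr (\<alpha> - 1))"
      using d assms(1) by simp
    also have "\<dots> \<le> integral {a + d..a + 2 * d} (\<lambda>x. \<tau> x * W x)"
    proof (rule integral_le)
      show "(\<lambda>x. \<tau> x * W x) integrable_on {a + d..a + 2 * d}"
        by (rule integrable_on_subinterval[OF \<tau>W]) (use d in auto)
      fix x assume x: "x \<in> {a + d..a + 2 * d}"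
      then show "(b - a) powr (\<alpha> - 1) \<le> \<tau> x * W x"
        using d assms by (auto simp: \<tau>_def W_def trapezoid_eq_1 intro!: powr_mono2')
    qed auto
    also have "\<dots> \<le> integral {a..b} (\<lambda>x. \<tau> x * W x)"
    proof (rule integral_subset_le)
      show "(\<lambda>x. \<tau> x * W x) integrable_on {a + d..a + 2 * d}"
        by (rule integrable_on_subinterval[OF \<tau>W]) (use d in auto)
    qed (use \<tau>W d in \<open>auto simp: \<tau>_def W_def trapezoid_bounds\<close>)
    also have "\<dots> = Gamma \<alpha> * m0"
      using m0 by (simp add: caputo_test_def W_def)
    finally show ?thesis using Gamma by (simp add: zero_less_mult_iff)
  qed

  \<comment> \<open>This choice is forced: \<open>Gamma \<alpha> * m0\<close> is the integral of
    \<open>\<tau> x * W x\<close>, so for constant \<open>f\<close> the quotient returns that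
    constant.\<close>
  define K where "K = integral {a..b} (\<lambda>x. f x * \<tau> x * W x) / (Gamma \<alpha> * m0)"
  have fK: "(\<lambda>x. f x - K) absolutely_integrable_on {a..b}"
    by (rule set_integral_diff(1)[OF assms(4)]) (auto intro: absolutely_integrable_continuous_real)
  have orth: "integral {a..b} (\<lambda>x. (f x - K) * trapezoid s t h x * W x) = 0"
    if st: "a \<le> s" "s \<le> t" "0 < h" "t + h < b" for s t h
  proof -
    let ?\<theta> = "trapezoid s t h"
    obtain m where m: "caputo_test a b \<alpha> ?\<theta> m"
      using assms st caputo_test_trapezoid[of \<alpha> a s t h b] by auto
    have f\<theta>: "(\<lambda>x. f x * ?\<theta> x * W x) absolutely_integrable_on {a..b}"
      using st assms by (intro trapezoid_int) auto
    have \<theta>W: "(\<lambda>x. ?\<theta> x * W x) integrable_on {a..b}"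
      using trapezoid_int[of s t h "\<lambda>_. 1"] st
      by (simp add: set_lebesgue_integral_eq_integral)
    \<comment> \<open>This multiple of \<open>\<tau>\<close> cancels the terminal value
      \<open>m\<close>.\<close>
    define r where "r = m / m0"
    have "caputo_test a b \<alpha> (\<lambda>x. 1 * ?\<theta> x + (- r) * \<tau> x) (1 * m + (- r) * m0)"
      by (intro caputo_test_lincomb assms m m0)
    moreover have "1 * m + (- r) * m0 = 0" using \<open>m0 > 0\<close> by (simp add: r_def)
    ultimately have test: "caputo_test a b \<alpha> (\<lambda>x. ?\<theta> x - r * \<tau> x) 0" by simp
    have split: "f x * (?\<theta> x - r * \<tau> x) * W x = f x * ?\<theta> x * W x - r * (f x * \<tau> x * W x)" for x
      by (simp add: algebra_simps)
    have "(\<lambda>x. f x * (?\<theta> x - r * \<tau> x) * W x) absolutely_integrable_on {a..b}"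
      unfolding split by (intro set_integral_diff set_integrable_mult_right f\<theta> f\<tau>)
    then have "integral {a..b} (\<lambda>x. f x * (?\<theta> x - r * \<tau> x) * W x) = 0"
      using caputo_test_0_orthogonal[OF assms(1-3) test _ assms(9)] by (simp add: W_def)
    also have "integral {a..b} (\<lambda>x. f x * (?\<theta> x - r * \<tau> x) * W x) =
        integral {a..b} (\<lambda>x. f x * ?\<theta> x * W x) - r * integral {a..b} (\<lambda>x. f x * \<tau> x * W x)"
      unfolding split using f\<theta> f\<tau>
      by (subst integral_diff) (auto intro!: integrable_on_mult_right simp: set_lebesgue_integral_eq_integral)
    \<comment> \<open>By the choice of \<open>r\<close> and \<open>K\<close> the correction is
      \<open>K\<close> times the integral of \<open>?\<theta> x * W x\<close>, so it amounts to
      replacing \<open>f\<close> by \<open>f - K\<close>.\<close>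
    also have "r * integral {a..b} (\<lambda>x. f x * \<tau> x * W x) = K * (Gamma \<alpha> * m)"
      using Gamma \<open>m0 > 0\<close> by (simp add: r_def K_def)
    also have "Gamma \<alpha> * m = integral {a..b} (\<lambda>x. ?\<theta> x * W x)"
      using m by (simp add: caputo_test_def W_def)
    also have "integral {a..b} (\<lambda>x. f x * ?\<theta> x * W x) - K * integral {a..b} (\<lambda>x. ?\<theta> x * W x) =
        integral {a..b} (\<lambda>x. f x * ?\<theta> x * W x - K * (?\<theta> x * W x))"
      using f\<theta> \<theta>W
      by (subst integral_diff) (auto intro!: integrable_on_mult_right simp: set_lebesgue_integral_eq_integral)
    finally show ?thesis by (simp add: algebra_simps)
  qed

  define F where "F x = (f x - K) * W x" for x
  have F_int: "F absolutely_integrable_on {a..c}" if "c < b" for c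
  proof -
    have "(\<lambda>x. W x * (f x - K)) absolutely_integrable_on {a..c}"
    proof (rule absolutely_integrable_continuous_mult)
      show "continuous_on {a..c} W"
        unfolding W_def using that by (intro continuous_intros) auto
      show "(\<lambda>x. f x - K) absolutely_integrable_on {a..c}"
        by (rule set_integrable_subset[OF fK]) (use that in auto)
    qed
    then show ?thesis by (simp add: F_def[abs_def] mult.commute)
  qed
  have Ioc: "(LINT x:{s<..t}|lebesgue. F x) = 0" if st: "a \<le> s" "s < t" "t < b" for s t
  proof -
    \<comment> \<open>The room between \<open>t\<close> and \<open>b\<close> keeps every falling
      slope, of width at most \<open>e = c - t\<close>, inside \<open>{a..c}\<close>, where
      \<open>F\<close> is integrable and serves as dominating function.\<close>
    obtain c where c': "t < c" "c < b" using dense[OF st(3)] by blast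
    define e where "e = c - t"
    have c: "t < c" "c < b" "0 < e" "t + e = c" using c' by (simp_all add: e_def)
    have e: "0 < e / Suc n" "t + e / Suc n \<le> c" for n
    proof -
      show "0 < e / Suc n" using c by simp
      have "e / Suc n \<le> e / 1" using c by (intro divide_left_mono) auto
      then show "t + e / Suc n \<le> c" using c by simp
    qed
    let ?T = "\<lambda>n. trapezoid s t (e / Suc n)"
    have "(\<lambda>n. LINT x|lebesgue. indicator {a..b} x *\<^sub>R ((f x - K) * ?T n x * W x))
        \<longlonglongrightarrow> (LINT x|lebesgue. indicator {s<..t} x *\<^sub>R F x)"
    proof (rule integral_dominated_convergence[where w = "\<lambda>x. \<bar>indicator {a..c} x *\<^sub>R F x\<bar>"])
      show "(\<lambda>x. indicator {s<..t} x *\<^sub>R F x) \<in> borel_measurable lebesgue"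
      proof -
        have "set_integrable lebesgue {s<..t} F"
          by (rule set_integrable_subset[OF F_int[OF st(3)]]) (use st in auto)
        then show ?thesis unfolding set_integrable_def by (rule borel_measurable_integrable)
      qed
      show "(\<lambda>x. indicator {a..b} x *\<^sub>R ((f x - K) * ?T n x * W x)) \<in> borel_measurable lebesgue" for n
        using trapezoid_int[of s t "e / Suc n", OF _ e(1) _ fK] st c e(2)[of n]
        unfolding set_integrable_def by (intro borel_measurable_integrable) auto
      show "integrable lebesgue (\<lambda>x. \<bar>indicator {a..c} x *\<^sub>R F x\<bar>)"
        using F_int[OF c(2)] unfolding set_integrable_def by (rule integrable_abs)
      show "AE x in lebesgue. (\<lambda>n. indicator {a..b} x *\<^sub>R ((f x - K) * ?T n x * W x))
          \<longlonglongrightarrow> indicator {s<..t} x *\<^sub>R F x"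
      proof (rule AE_I2)
        fix x
        have "(\<lambda>n. indicator {a..b} x *\<^sub>R ((f x - K) * ?T n x * W x)) \<longlonglongrightarrow>
            indicator {a..b} x *\<^sub>R ((f x - K) * indicator {s<..t} x * W x)"
          using trapezoid_tendsto_indicator[OF st(2) c(3), of x] by (intro tendsto_intros)
        also have "indicator {a..b} x *\<^sub>R ((f x - K) * indicator {s<..t} x * W x) =
            indicator {s<..t} x *\<^sub>R F x"
          using st by (auto simp: indicator_def F_def)
        finally show "(\<lambda>n. indicator {a..b} x *\<^sub>R ((f x - K) * ?T n x * W x))
          \<longlonglongrightarrow> indicator {s<..t} x *\<^sub>R F x" .
      qed
      show "AE x in lebesgue. norm (indicator {a..b} x *\<^sub>R ((f x - K) * ?T n x * W x))
          \<le> \<bar>indicator {a..c} x *\<^sub>R F x\<bar>" for n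
      proof (rule AE_I2)
        fix x
        have "?T n x = 0" if "c < x"
          using that e[of n] st by (intro trapezoid_eq_0) auto
        moreover have "\<bar>F x * ?T n x\<bar> \<le> \<bar>F x\<bar> * 1"
          unfolding abs_mult using trapezoid_bounds[OF e(1)[of n], of s t x] st
          by (intro mult_left_mono) auto
        ultimately show "norm (indicator {a..b} x *\<^sub>R ((f x - K) * ?T n x * W x))
            \<le> \<bar>indicator {a..c} x *\<^sub>R F x\<bar>"
          by (cases "c < x") (auto simp: indicator_def F_def ac_simps)
      qed
    qed
    moreover have "(LINT x|lebesgue. indicator {a..b} x *\<^sub>R ((f x - K) * ?T n x * W x)) = 0" for n
    proof -
      have "t + e / Suc n < b" using e(2)[of n] c by linarith
      then have "(LINT x:{a..b}|lebesgue. (f x - K) * ?T n x * W x) = 0"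
        using orth[of s t "e / Suc n"] trapezoid_int[of s t "e / Suc n", OF _ e(1) _ fK] st e(1)[of n]
        by (simp add: set_lebesgue_integral_eq_integral)
      then show ?thesis unfolding set_lebesgue_integral_def .
    qed
    ultimately have "(\<lambda>n. 0) \<longlonglongrightarrow> (LINT x|lebesgue. indicator {s<..t} x *\<^sub>R F x)"
      by simp
    then show ?thesis by (simp add: LIMSEQ_const_iff set_lebesgue_integral_def)
  qed
  have AE_c: "AE x in lebesgue. x \<in> {a..c} \<longrightarrow> f x = K" if "c < b" for c
  proof -
    let ?h = "\<lambda>x. indicator {a..c} x *\<^sub>R F x"
    have "AE x in lebesgue. ?h x = 0"
    proof (rule AE_eq_0_if_Icc_integrals_0)
      show "integrable lebesgue ?h"
        using F_int[OF that] by (simp add: set_integrable_def)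
      fix s t :: real
      \<comment> \<open>Clipping an arbitrary interval to \<open>{a..c}\<close> reduces it to
        \<open>Ioc\<close>; closed and half-open versions differ by one point, and an empty or
        degenerate clip gives 0.\<close>
      let ?s = "max s a" and ?t = "min t c"
      have "(LINT x:{s..t}|lebesgue. ?h x) = (LINT x:{?s..?t}|lebesgue. F x)"
        unfolding set_lebesgue_integral_def
        by (rule Bochner_Integration.integral_cong) (auto simp: indicator_def)
      also have "\<dots> = (LINT x:{?s<..?t}|lebesgue. F x)"
      proof (rule set_integral_cong_set)
        have "AE x in lebesgue. x \<noteq> ?s"
          using AE_not_in[of "{?s}" lebesgue] by simp
        then show "AE x in lebesgue. (x \<in> {?s<..?t}) = (x \<in> {?s..?t})"
          by eventually_elim auto
        have "set_integrable lebesgue {?s..?t} F" "set_integrable lebesgue {?s<..?t} F"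
          by (rule set_integrable_subset[OF F_int[OF that]]; auto)+
        then show "set_borel_measurable lebesgue {?s..?t} F" "set_borel_measurable lebesgue {?s<..?t} F"
          unfolding set_integrable_def set_borel_measurable_def by (auto dest: borel_measurable_integrable)
      qed
      also have "\<dots> = 0"
        using Ioc[of ?s ?t] that by (cases "?s < ?t") (auto simp: set_lebesgue_integral_def)
      finally show "(LINT x:{s..t}|lebesgue. ?h x) = 0" .
    qed
    then show ?thesis
    proof eventually_elim
      case (elim x)
      show ?case
      proof
        assume "x \<in> {a..c}"
        \<comment> \<open>Here \<open>x \<le> c < b\<close>; at \<open>b\<close> itself
          \<open>W\<close> would be 0.\<close>
        moreover from this have "W x \<noteq> 0" using that by (simp add: W_def)
        ultimately show "f x = K" using elim by (simp add: F_def)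
      qed
    qed
  qed
  \<comment> \<open>Countably many intervals \<open>{a..b - 1 / Suc n}\<close> exhaust all of
    \<open>{a..b}\<close> except the null point \<open>b\<close>.\<close>
  have "AE x in lebesgue. \<forall>n. x \<in> {a..b - 1 / Suc n} \<longrightarrow> f x = K"
    unfolding AE_all_countable by (intro allI AE_c) simp
  moreover have "AE x in lebesgue. x \<noteq> b"
    using AE_not_in[of "{b}" lebesgue] by simp
  ultimately have "AE x in lebesgue. x \<in> {a..b} \<longrightarrow> f x = K"
  proof eventually_elim
    case (elim x)
    show ?case
    proof
      assume x: "x \<in> {a..b}"
      then have "0 < b - x" using elim by simp
      then obtain n where "1 / Suc n < b - x" using nat_approx_posE by blast
      then show "f x = K" using elim(1)[rule_format, of n] x by simp
    qed
  qed
  then show ?thesis by blast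
qed

end
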